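(* Let $q$ be a prime power, let $i<n$ be positive integers and let $\lambda_i=\genfrac{[}{]}{0pt}{}{n-1}{i-1}_q$. Let $\mathcal{F}^i$ be the collection of factors $F_\Pi$ of the complete multigraph on the $q^n$ points of $\mathrm{AG}(n,q)$, one for each $(i-1)$-dimensional subspace $\Pi$ of the hyperplane at infinity $\mathcal{H}_\infty\cong\mathrm{PG}(n-1,q)$, where $F_\Pi$ is the vertex-disjoint union of the complete graphs on the point sets of the $q^{n-i}$ parallel affine $i$-spaces whose projective closures meet $\mathcal{H}_\infty$ in $\Pi$. Then $\mathcal{F}^i$ is a simple $(q^i-1)$-factorization of $\lambda_i K_{q^n}$. Moreover, $\mathcal{F}^i$ is decomposable if and only if there exists an $f$-fold $(i-1)$-spread in $\mathrm{PG}(n-1,q)$ for some integer $f$ with $1\le f<\lambda_i$.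
   Context: The complete multigraph $\lambda K_v$ has $v$ vertices and exactly $\lambda$ edges joining each pair of distinct vertices. An $m$-factor of $\lambda K_v$ is a set of pairwise vertex-disjoint $m$-regular subgraphs which induce a partition of the vertices (i.e. a spanning $m$-regular subgraph). An $m$-factorization of $\lambda K_v$ is a collection of pairwise edge-disjoint $m$-factors inducing a partition of the edges; equivalently, regarding factors as graphs on the $v$ vertices, a family (multiset) of $m$-regular simple spanning graphs (all factors here are simple graphs) such that each pair of distinct vertices is joined in exactly $\lambda$ of them. It is simple if its $m$-factors are pairwise distinct (as graphs on the vertex set). It is decomposable if there exist positive integers $\mu_1,\mu_2$ with $\mu_1+\mu_2=\lambda$ such that it is the union of an $m$-factorization of $\mu_1K_v$ and an $m$-factorization of $\mu_2K_v$; otherwise it is indecomposable. $\genfrac{[}{]}{0pt}{}{n}{k}_q$ denotes the Gaussian binomial coefficient, the number of $k$-dimensional subspaces of an $n$-dimensional vector space over $\mathrm{GF}(q)$. $\mathrm{PG}(n,q)$ is the $n$-dimensional projective space over $\mathrm{GF}(q)$; a $k$-space is a $k$-dimensional projective subspace. $\mathrm{AG}(n,q)=\mathrm{PG}(n,q)\setminus\mathcal{H}_\infty$ for a fixed hyperplane $\mathcal{H}_\infty$ (the hyperplane at infinity); affine subspaces are projective subspaces not contained in $\mathcal{H}_\infty$ with their points in $\mathcal{H}_\infty$ deleted. An $f$-fold $j$-spread of a projective space is a set of $j$-dimensional subspaces such that every point is contained in exactly $f$ of them. *)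

theory Defs
  imports
    "HOL-Analysis.Cartesian_Space"
    "HOL-Library.Multiset"
    "HOL-Library.Disjoint_Sets"
    "HOL-Number_Theory.Prime_Powers"
begin

section \<open>Factorizations of complete multigraphs\<close>

text \<open>
  All graphs are simple graphs on a fixed finite vertex set \<open>V\<close>, and are identified with their
  set of edges, an edge being a two-element set of vertices. A multigraph is a multiset of edges.
\<close>

definition complete_graph :: "'v set \<Rightarrow> 'v set set" where
  "complete_graph V = {e. e \<subseteq> V \<and> card e = 2}"

definition complete_multigraph :: "nat \<Rightarrow> 'v set \<Rightarrow> 'v set multiset" where
  "complete_multigraph lam V = repeat_mset lam (mset_set (complete_graph V))"

definition is_factor :: "'v set \<Rightarrow> nat \<Rightarrow> 'v set set \<Rightarrow> bool" where
  "is_factor V m E \<longleftrightarrow> E \<subseteq> complete_graph V \<and> (\<forall>x\<in>V. card {e \<in> E. x \<in> e} = m)"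

text \<open>
  The sum of the edge sets, counted with multiplicity, is the edge multiset of \<open>\<lambda>K\<^sub>V\<close>; that is,
  each pair of distinct vertices is joined in exactly \<open>\<lambda>\<close> members of the family.
\<close>

definition is_factorization :: "nat \<Rightarrow> 'v set \<Rightarrow> nat \<Rightarrow> 'v set set multiset \<Rightarrow> bool" where
  "is_factorization lam V m F \<longleftrightarrow>
     (\<forall>E \<in># F. is_factor V m E) \<and>
     (\<Sum>E \<in># F. mset_set E) = complete_multigraph lam V"

definition simple_family :: "'v set set multiset \<Rightarrow> bool" where
  "simple_family F \<longleftrightarrow> (\<forall>E \<in># F. count F E = 1)"

definition decomposable :: "nat \<Rightarrow> 'v set \<Rightarrow> nat \<Rightarrow> 'v set set multiset \<Rightarrow> bool" where
  "decomposable lam V m F \<longleftrightarrow>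
     (\<exists>mu1 mu2 F1 F2. 0 < mu1 \<and> 0 < mu2 \<and> mu1 + mu2 = lam \<and> F = F1 + F2 \<and>
        is_factorization mu1 V m F1 \<and> is_factorization mu2 V m F2)"

section \<open>Projective and affine spaces\<close>

text \<open>
  \<open>PG(d,q)\<close> is the projective space of the vector space \<open>'a ^ 'd\<close> where \<open>CARD('a) = q\<close> and
  \<open>CARD('d) = d + 1\<close>. A projective subspace is represented by the linear subspace underlying it,
  whose linear dimension is one more than the projective dimension. In particular points are
  one-dimensional linear subspaces, and a point \<open>P\<close> lies on \<open>U\<close> iff \<open>P \<subseteq> U\<close>.
\<close>

definition proj_space :: "nat \<Rightarrow> ('a::field ^ 'd::finite) set \<Rightarrow> bool" where
  "proj_space k U \<longleftrightarrow> vec.subspace U \<and> vec.dim U = k + 1"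

definition fold_spread :: "nat \<Rightarrow> nat \<Rightarrow> ('a::field ^ 'd::finite) set set \<Rightarrow> bool" where
  "fold_spread f j S \<longleftrightarrow>
     (\<forall>U\<in>S. proj_space j U) \<and> (\<forall>P. proj_space 0 P \<longrightarrow> card {U \<in> S. P \<subseteq> U} = f)"

text \<open>\<open>affine_part H U\<close> is the set of points of \<open>U\<close> that do not lie on the hyperplane \<open>H\<close>.\<close>

definition affine_part ::
    "('a::field ^ 'd::finite) set \<Rightarrow> ('a ^ 'd) set \<Rightarrow> ('a ^ 'd) set set" where
  "affine_part H U = {P. proj_space 0 P \<and> P \<subseteq> U \<and> \<not> P \<subseteq> H}"

abbreviation AG_points :: "('a::field ^ 'd::finite) set \<Rightarrow> ('a ^ 'd) set set" where
  "AG_points H \<equiv> affine_part H UNIV"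

definition parallel_class ::
    "('a::field ^ 'd::finite) set \<Rightarrow> nat \<Rightarrow> ('a ^ 'd) set \<Rightarrow> ('a ^ 'd) set set set" where
  "parallel_class H i D =
     {affine_part H U | U. proj_space i U \<and> \<not> U \<subseteq> H \<and> U \<inter> H = D}"

definition parallel_factor ::
    "('a::field ^ 'd::finite) set \<Rightarrow> nat \<Rightarrow> ('a ^ 'd) set \<Rightarrow> ('a ^ 'd) set set set" where
  "parallel_factor H i D = (\<Union>A \<in> parallel_class H i D. complete_graph A)"

text \<open>
  The family is indexed by the subspaces \<open>D\<close>, so that equal factors arising from different \<open>D\<close>
  would be counted repeatedly.
\<close>

definition parallel_family ::
    "('a::{field,finite} ^ 'd::finite) set \<Rightarrow> nat \<Rightarrow> ('a ^ 'd) set set set multiset" where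
  "parallel_family H i =
     image_mset (parallel_factor H i) (mset_set {D. proj_space (i - 1) D \<and> D \<subseteq> H})"

text \<open>The Gaussian binomial coefficient with parameters \<open>CARD('d)\<close>, \<open>k\<close> and \<open>q = CARD('a)\<close>.\<close>

definition gaussian_binomial :: "('a::{field,finite} ^ 'd::finite) itself \<Rightarrow> nat \<Rightarrow> nat" where
  "gaussian_binomial _ k = card {U :: ('a ^ 'd) set. vec.subspace U \<and> vec.dim U = k}"

end

theory Submission
  imports Defs
begin

text \<open>
  Fix a vector \<open>p\<close> outside the hyperplane \<open>H\<close>. Every affine point is spanned by exactly one vector of
  the form \<open>p + h\<close> with \<open>h \<in> H\<close>, so the affine points are coordinatized by the vectors of \<open>H\<close>
  (\<open>inj_on_affine_point\<close>, \<open>AG_points_eq\<close>). In these coordinates the affine subspaces whose closure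
  meets \<open>H\<close> in \<open>D\<close> are the cosets of \<open>D\<close> in \<open>H\<close> (\<open>parallel_class_eq\<close>). They partition \<open>H\<close>, which gives
  the number and the sizes of the blocks, and two points \<open>h \<noteq> k\<close> are joined in the factor of \<open>D\<close> if and
  only if \<open>h - k \<in> D\<close> (\<open>edge_mem_parallel_factor_iff\<close>). Geometrically, the line through the two points
  meets \<open>H\<close> in the projective point spanned by \<open>h - k\<close>, and the edge lies in the factor precisely when
  that point lies on \<open>D\<close>.

  Consequently the factors of a set \<open>T\<close> of subspaces form a factorization of \<open>\<mu>K\<close> exactly if each
  projective point of \<open>H\<close> lies on exactly \<open>\<mu>\<close> members of \<open>T\<close> (\<open>factorization_iff_uniform_cover\<close>). When
  \<open>T\<close> consists of all subspaces of the prescribed dimension, the number of members through a point is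
  the Gaussian binomial coefficient, because they correspond to the subspaces of one dimension less
  in a complement of the point (\<open>card_subspaces_through_point\<close>). Distinct subspaces have
  distinct factors, so the family is simple, and a subfamily of factors is the same thing as
  a subset of the subspaces at infinity. A decomposition is therefore a splitting of all these subspaces
  into two spreads, and since the complement of an \<open>f\<close>-fold spread covers every point
  \<open>\<lambda> - f\<close> times, one spread with \<open>1 \<le> f < \<lambda>\<close> suffices (\<open>decomposable_iff_proper_cover\<close>). Finally, a linear
  isomorphism identifies \<open>H\<close> with the coordinate space in which the spread is
  sought (\<open>ex_fold_spread_iff\<close>).
\<close>

section \<open>Linear and projective subspaces\<close>

lemma subspace_scale_iff: "vec.subspace U \<Longrightarrow> c \<noteq> 0 \<Longrightarrow> c *s v \<in> U \<longleftrightarrow> v \<in> U"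
  for U :: "('a::field ^ 'm::finite) set"
  using vec.subspace_scale[of U v c] vec.subspace_scale[of U "c *s v" "inverse c"]
  by auto

lemma mem_span_insert_subspace:
  "vec.subspace U \<Longrightarrow> v \<in> vec.span (insert b U) \<longleftrightarrow> (\<exists>c. v - c *s b \<in> U)"
  for U :: "('a::field ^ 'm::finite) set"
  by (simp add: vec.span_breakdown_eq vec.span_eq_iff[THEN iffD2])

lemma diff_swap_mem_iff: "vec.subspace D \<Longrightarrow> h - k \<in> D \<longleftrightarrow> k - h \<in> D"
  for D :: "('a::field ^ 'm::finite) set"
  using vec.subspace_neg[of D "h - k"] vec.subspace_neg[of D "k - h"] by auto

lemma card_subspace:
  fixes U :: "('a::{field,finite} ^ 'm::finite) set"
  assumes "vec.subspace U"
  shows "card U = CARD('a) ^ vec.dim U"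
proof -
  \<comment> \<open>Adjoining an independent \<open>b\<close> multiplies the size by the number of scalars, since the
    coefficient of \<open>b\<close> and the remainder are both determined by the vector.\<close>
  have card_span: "card (vec.span B) = CARD('a) ^ card B"
    if "finite B" "vec.independent B" for B :: "('a ^ 'm) set"
    using that
  proof (induction B)
    case (insert b B)
    then have b: "b \<notin> vec.span B" and B: "vec.independent B"
      by (simp_all add: vec.independent_insert)
    have "bij_betw (\<lambda>(c, x). c *s b + x) (UNIV \<times> vec.span B) (vec.span (insert b B))"
      unfolding bij_betw_def
    proof
      show "inj_on (\<lambda>(c, x). c *s b + x) (UNIV \<times> vec.span B)"
      proof (clarsimp simp: inj_on_def, rule ccontr)
        fix c x d y
        assume xy: "x \<in> vec.span B" "y \<in> vec.span B" "c *s b + x = d *s b + y"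
          and ne: "\<not> (c = d \<and> x = y)"
        then have cd: "c \<noteq> d"
          by auto
        have "(c - d) *s b = y - x"
          using xy(3) by (simp add: vec.scale_left_diff_distrib algebra_simps)
        then have "(c - d) *s b \<in> vec.span B"
          using xy by (simp add: vec.span_diff)
        then show False
          using b cd subspace_scale_iff[OF vec.subspace_span, of "c - d" b B] by simp
      qed
      show "(\<lambda>(c, x). c *s b + x) ` (UNIV \<times> vec.span B) = vec.span (insert b B)"
      proof
        show "(\<lambda>(c, x). c *s b + x) ` (UNIV \<times> vec.span B) \<subseteq> vec.span (insert b B)"
        proof clarify
          fix c x assume "x \<in> vec.span B"
          then show "c *s b + x \<in> vec.span (insert b B)"
            by (auto simp: vec.span_breakdown_eq intro!: exI[where x = c])
        qed
        show "vec.span (insert b B) \<subseteq> (\<lambda>(c, x). c *s b + x) ` (UNIV \<times> vec.span B)"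
        proof
          fix v assume "v \<in> vec.span (insert b B)"
          then obtain c where "v - c *s b \<in> vec.span B"
            by (auto simp: vec.span_breakdown_eq)
          then show "v \<in> (\<lambda>(c, x). c *s b + x) ` (UNIV \<times> vec.span B)"
            by (intro image_eqI[where x = "(c, v - c *s b)"]) auto
        qed
      qed
    qed
    then have "card (vec.span (insert b B)) = card ((UNIV :: 'a set) \<times> vec.span B)"
      by (simp add: bij_betw_same_card)
    then show ?case
      using insert B by (simp add: card_cartesian_product)
  qed simp
  obtain B where "finite B" "vec.independent B" "vec.span B = U" "card B = vec.dim U"
    using vec.basis_subspace_exists[OF assms] by metis
  then show ?thesis
    using card_span by metis
qed

lemma bij_betw_subspaces_image:
  fixes g :: "'a::field ^ 'k::finite \<Rightarrow> 'a ^ 'm::finite"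
  assumes g: "Vector_Spaces.linear (*s) (*s) g" "inj g"
  shows "bij_betw ((`) g) {U. vec.subspace U \<and> vec.dim U = j}
           {U. vec.subspace U \<and> vec.dim U = j \<and> U \<subseteq> range g}"
proof (rule bij_betw_imageI)
  show "inj_on ((`) g) {U. vec.subspace U \<and> vec.dim U = j}"
    using g(2) by (simp add: inj_on_def inj_image_eq_iff)
  have dim: "vec.dim (g ` U) = vec.dim U" for U
    by (rule vec.dim_image_eq[OF g(1)]) (use g(2) in \<open>auto intro: inj_on_subset\<close>)
  show "(`) g ` {U. vec.subspace U \<and> vec.dim U = j} =
      {U. vec.subspace U \<and> vec.dim U = j \<and> U \<subseteq> range g}"
  proof (intro equalityI subsetI)
    fix W assume "W \<in> (`) g ` {U. vec.subspace U \<and> vec.dim U = j}"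
    then show "W \<in> {U. vec.subspace U \<and> vec.dim U = j \<and> U \<subseteq> range g}"
      using dim vec.linear_subspace_image[OF g(1)] by auto
  next
    fix W assume W: "W \<in> {U. vec.subspace U \<and> vec.dim U = j \<and> U \<subseteq> range g}"
    then have gW: "g ` (g -` W) = W"
      by auto
    moreover have "vec.subspace (g -` W)"
      using vec.linear_subspace_vimage[OF g(1)] W by auto
    ultimately show "W \<in> (`) g ` {U. vec.subspace U \<and> vec.dim U = j}"
      using W dim[of "g -` W"] by (intro image_eqI[where x = "g -` W"]) auto
  qed
qed

text \<open>
  Subspaces of a given dimension have no coordinate type of their own. This embedding moves counting
  problems and spreads between a subspace and the coordinate space of the same dimension.
\<close>

lemma linear_embedding_onto_subspace:
  fixes W :: "('a::field ^ 'm::finite) set"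
  assumes "vec.subspace W" "vec.dim W = CARD('k::finite)"
  obtains g :: "'a ^ 'k \<Rightarrow> 'a ^ 'm"
  where "Vector_Spaces.linear (*s) (*s) g" "inj g" "range g = W"
proof -
  have "vec.dim (UNIV :: ('a ^ 'k) set) = vec.dim W"
    by (simp add: assms(2) vec_dim_card del: vec.dim_UNIV)
  then show ?thesis
    using vec.subspace_isomorphism[OF vec.subspace_UNIV assms(1)] that by metis
qed

text \<open>
  A subspace \<open>D\<close> through \<open>b\<close> is recovered from its trace \<open>D \<inter> W\<close> on a complement \<open>W\<close> of \<open>b\<close> by adjoining
  \<open>b\<close> again. This replaces the passage to the quotient by \<open>b\<close>.
\<close>

lemma bij_betw_subspaces_through_vector:
  fixes W :: "('a::field ^ 'm::finite) set"
  assumes W: "vec.subspace W" and b: "b \<notin> W"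
  shows "bij_betw (\<lambda>A. vec.span (insert b A))
           {A. vec.subspace A \<and> vec.dim A = j \<and> A \<subseteq> W}
           {D. vec.subspace D \<and> vec.dim D = Suc j \<and> D \<subseteq> vec.span (insert b W) \<and> b \<in> D}"
    (is "bij_betw ?f ?X ?Y")
proof (rule bij_betw_byWitness[where f' = "\<lambda>D. D \<inter> W"])
  have sect: "?f A \<inter> W = A" if A: "vec.subspace A" "A \<subseteq> W" for A
  proof (intro equalityI subsetI)
    fix v assume v: "v \<in> ?f A \<inter> W"
    then obtain c where c: "v - c *s b \<in> A"
      using A by (auto simp: mem_span_insert_subspace)
    then have "c *s b \<in> W"
      using vec.subspace_diff[OF W, of v "v - c *s b"] v A by auto
    then have "c = 0"
      using b subspace_scale_iff[OF W, of c b] by auto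
    then show "v \<in> A"
      using c by simp
  qed (use A in \<open>auto intro: vec.span_base\<close>)
  have join: "?f (D \<inter> W) = D" if D: "D \<in> ?Y" for D
  proof (intro equalityI subsetI)
    fix v assume "v \<in> D"
    moreover from this have "v \<in> vec.span (insert b W)"
      using D by auto
    then obtain c where "v - c *s b \<in> W"
      using W by (auto simp: mem_span_insert_subspace)
    ultimately have "v - c *s b \<in> D \<inter> W"
      using D by (auto intro: vec.subspace_diff vec.subspace_scale)
    then show "v \<in> ?f (D \<inter> W)"
      by (auto simp: vec.span_breakdown_eq intro: vec.span_base)
  next
    fix v assume "v \<in> ?f (D \<inter> W)"
    moreover have "?f (D \<inter> W) \<subseteq> D"
      using D by (intro vec.span_minimal) auto
    ultimately show "v \<in> D"
      by blast
  qed
  have dim: "vec.dim (?f A) = Suc (vec.dim A)" if "vec.subspace A" "A \<subseteq> W" for A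
    using that b by (auto simp: vec.dim_insert vec.span_eq_iff[THEN iffD2])
  show "\<forall>A\<in>?X. ?f A \<inter> W = A"
    using sect by auto
  show "\<forall>D\<in>?Y. ?f (D \<inter> W) = D"
    using join by auto
  show "?f ` ?X \<subseteq> ?Y"
    using dim by (auto intro: vec.span_base vec.span_mono[THEN subsetD, rotated])
  show "(\<lambda>D. D \<inter> W) ` ?Y \<subseteq> ?X"
  proof clarify
    fix D assume D: "vec.subspace D" "vec.dim D = Suc j" "D \<subseteq> vec.span (insert b W)" "b \<in> D"
    have "vec.subspace (D \<inter> W)"
      using D W by (simp add: vec.subspace_inter)
    then show "vec.subspace (D \<inter> W) \<and> vec.dim (D \<inter> W) = j \<and> D \<inter> W \<subseteq> W"
      using dim[of "D \<inter> W"] join[of D] D by auto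
  qed
qed

lemma proj_point_iff: "proj_space 0 P \<longleftrightarrow> (\<exists>v. v \<noteq> 0 \<and> P = vec.span {v})"
  for P :: "('a::field ^ 'm::finite) set"
proof
  assume "proj_space 0 P"
  then have P: "vec.subspace P" "vec.dim P = 1"
    by (auto simp: proj_space_def)
  then have "\<not> P \<subseteq> {0}"
    by (metis vec.dim_eq_0 zero_neq_one)
  then obtain v where v: "v \<in> P" "v \<noteq> 0"
    by auto
  have "vec.span {v} = P"
    using P v by (intro vec.subspace_dim_equal vec.span_minimal) auto
  then show "\<exists>v. v \<noteq> 0 \<and> P = vec.span {v}"
    using v by auto
qed (auto simp: proj_space_def)

lemma span_singleton_subset_iff: "vec.subspace U \<Longrightarrow> vec.span {v} \<subseteq> U \<longleftrightarrow> v \<in> U"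
  for U :: "('a::field ^ 'm::finite) set"
  using vec.span_minimal[of "{v}" U] vec.span_base[of v "{v}"] by auto

lemma span_scaled_singleton: "c \<noteq> 0 \<Longrightarrow> vec.span {c *s v} = vec.span {v}"
  for v :: "'a::field ^ 'm::finite"
  by (intro equalityI)
    (simp_all add: span_singleton_subset_iff subspace_scale_iff vec.span_base
      subspace_scale_iff[symmetric, where c = c and v = v])

text \<open>
  The subspaces through a point correspond to the subspaces of one dimension less in a complement of
  that point, and such a complement is a copy of the space over the index type \<open>'l\<close>. This count is the
  value of \<open>\<lambda>\<close>.
\<close>

lemma card_subspaces_through_point:
  fixes H :: "('a::{field,finite} ^ 'm::finite) set"
  assumes H: "vec.subspace H" "vec.dim H = Suc (CARD('l::finite))"
    and P: "proj_space 0 P" "P \<subseteq> H"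
  shows "card {D. vec.subspace D \<and> vec.dim D = Suc j \<and> D \<subseteq> H \<and> P \<subseteq> D} =
           gaussian_binomial TYPE('a ^ 'l) j"
proof -
  obtain b where b: "b \<noteq> 0" and Pb: "P = vec.span {b}"
    using P by (auto simp: proj_point_iff)
  have bH: "b \<in> H"
    using P H Pb by (simp add: span_singleton_subset_iff)
  obtain B where B: "{b} \<subseteq> B" "B \<subseteq> H" "vec.independent B" "H \<subseteq> vec.span B"
    using vec.maximal_independent_subset_extend[of "{b}" H] b bH by auto
  \<comment> \<open>\<open>B\<close> is a basis of \<open>H\<close> extending \<open>{b}\<close>, so that its other members span a complement of \<open>b\<close>.\<close>
  define W where "W = vec.span (B - {b})"
  have ins: "insert b (B - {b}) = B"
    using B by auto
  have bW: "b \<notin> W"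
    using B(3) vec.independent_insert[of b "B - {b}"] ins unfolding W_def by simp
  have W: "vec.subspace W"
    by (simp add: W_def)
  have HW: "vec.span (insert b W) = H"
  proof -
    have "vec.span (insert b W) = vec.span (insert b (B - {b}))"
      by (auto simp: W_def vec.span_breakdown_eq vec.span_span
          simp del: insert_Diff_single)
    also have "\<dots> = H"
      unfolding ins using B H by (intro equalityI vec.span_minimal) auto
    finally show ?thesis .
  qed
  have "vec.dim H = Suc (vec.dim W)"
    using bW W unfolding HW[symmetric] by (simp add: vec.dim_insert vec.span_eq_iff[THEN iffD2])
  then obtain g :: "'a ^ 'l \<Rightarrow> 'a ^ 'm"
    where g: "Vector_Spaces.linear (*s) (*s) g" "inj g" "range g = W"
    using linear_embedding_onto_subspace[OF W, where 'k = 'l] H(2) by auto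
  have "{D. vec.subspace D \<and> vec.dim D = Suc j \<and> D \<subseteq> H \<and> P \<subseteq> D} =
      {D. vec.subspace D \<and> vec.dim D = Suc j \<and> D \<subseteq> H \<and> b \<in> D}"
    using span_singleton_subset_iff[of _ b] unfolding Pb by blast
  then show ?thesis
    using bij_betw_same_card[OF bij_betw_subspaces_through_vector[OF W bW, of j]]
      bij_betw_same_card[OF bij_betw_subspaces_image[OF g(1,2), of j]]
    by (simp add: HW g(3) gaussian_binomial_def)
qed

section \<open>Edge multiplicities of a family of graphs\<close>

lemma count_edge_sum:
  fixes g :: "'b \<Rightarrow> 'e::finite set"
  assumes "finite T"
  shows "count (\<Sum>E \<in># image_mset g (mset_set T). mset_set E) e =
     card {D \<in> T. e \<in> g D}"
  using assms
proof (induction T)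
  case (insert D T)
  have "{D' \<in> insert D T. e \<in> g D'} =
      (if e \<in> g D then insert D {D' \<in> T. e \<in> g D'} else {D' \<in> T. e \<in> g D'})"
    by auto
  then show ?case
    using insert by (simp add: count_mset_set')
qed simp

section \<open>Spreads inside a subspace\<close>

text \<open>
  The covering condition of an \<open>f\<close>-fold spread, relative to a subspace \<open>W\<close>, so that spreads of the
  hyperplane at infinity can be treated inside the ambient space.
\<close>

definition uniform_cover :: "('a::field ^ 'm::finite) set \<Rightarrow> nat \<Rightarrow> ('a ^ 'm) set set \<Rightarrow> bool" where
  "uniform_cover W f T \<longleftrightarrow>
     (\<forall>P. proj_space 0 P \<and> P \<subseteq> W \<longrightarrow> card {D \<in> T. P \<subseteq> D} = f)"

lemma fold_spread_iff_uniform_cover: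
  "fold_spread f j S \<longleftrightarrow> S \<subseteq> {U. proj_space j U} \<and> uniform_cover UNIV f S"
  by (auto simp: fold_spread_def uniform_cover_def)

lemma uniform_cover_image:
  fixes g :: "'a::field ^ 'k::finite \<Rightarrow> 'a ^ 'm::finite"
  assumes g: "Vector_Spaces.linear (*s) (*s) g" "inj g"
  shows "uniform_cover (range g) f ((`) g ` S) \<longleftrightarrow> uniform_cover UNIV f S"
proof -
  have pencil: "card {D \<in> (`) g ` S. g ` P \<subseteq> D} = card {U \<in> S. P \<subseteq> U}" for P
  proof -
    have "{D \<in> (`) g ` S. g ` P \<subseteq> D} = (`) g ` {U \<in> S. P \<subseteq> U}"
      using inj_image_subset_iff[OF g(2)] by auto
    moreover have "inj_on ((`) g) {U \<in> S. P \<subseteq> U}"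
      using g(2) by (simp add: inj_on_def inj_image_eq_iff)
    ultimately show ?thesis
      by (simp add: card_image)
  qed
  have points: "{P. proj_space 0 P \<and> P \<subseteq> range g} = (`) g ` {P. proj_space 0 P}"
    using bij_betw_imp_surj_on[OF bij_betw_subspaces_image[OF g, of 1]]
    by (simp add: proj_space_def conj_assoc)
  have "uniform_cover (range g) f ((`) g ` S) \<longleftrightarrow>
      (\<forall>P\<in>{P. proj_space 0 P \<and> P \<subseteq> range g}. card {D \<in> (`) g ` S. P \<subseteq> D} = f)"
    by (simp add: uniform_cover_def)
  also have "\<dots> \<longleftrightarrow> uniform_cover UNIV f S"
    unfolding points by (simp add: pencil uniform_cover_def)
  finally show ?thesis .
qed

lemma ex_fold_spread_iff:
  fixes W :: "('a::field ^ 'm::finite) set"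
  assumes W: "vec.subspace W" "vec.dim W = CARD('k::finite)"
  shows "(\<exists>S :: ('a ^ 'k) set set. fold_spread f j S) \<longleftrightarrow>
         (\<exists>T \<subseteq> {D. proj_space j D \<and> D \<subseteq> W}. uniform_cover W f T)"
proof -
  obtain g :: "'a ^ 'k \<Rightarrow> 'a ^ 'm"
    where g: "Vector_Spaces.linear (*s) (*s) g" "inj g" "range g = W"
    using linear_embedding_onto_subspace[OF W] .
  have spaces: "{D. proj_space j D \<and> D \<subseteq> W} = (`) g ` {U. proj_space j U}"
    using bij_betw_imp_surj_on[OF bij_betw_subspaces_image[OF g(1,2), of "j + 1"]]
    by (simp add: proj_space_def conj_assoc g(3))
  have "(\<exists>T \<subseteq> {D. proj_space j D \<and> D \<subseteq> W}. uniform_cover W f T) \<longleftrightarrow>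
      (\<exists>S \<subseteq> {U. proj_space j U}. uniform_cover W f ((`) g ` S))"
    unfolding spaces by (auto simp: subset_image_iff)
  also have "\<dots> \<longleftrightarrow> (\<exists>S :: ('a ^ 'k) set set. fold_spread f j S)"
    using uniform_cover_image[OF g(1,2)] by (simp add: fold_spread_iff_uniform_cover g(3))
  finally show ?thesis
    by simp
qed

section \<open>Affine coordinates\<close>

text \<open>
  The vector \<open>p\<close> spans the affine point chosen as origin, and the affine point at position \<open>h \<in> H\<close>
  relative to this origin is spanned by \<open>p + h\<close>.
\<close>

locale affine_frame =
  fixes H :: "('a::{field,finite} ^ 'm::finite) set" and p :: "'a ^ 'm"
  assumes subspace_H: "vec.subspace H"
    and p_notin_H: "p \<notin> H"
    and span_frame: "vec.span (insert p H) = UNIV"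
begin

definition affine_point :: "'a ^ 'm \<Rightarrow> ('a ^ 'm) set" where
  "affine_point h = vec.span {p + h}"

lemma multiple_plus_mem_H_iff: "h \<in> H \<Longrightarrow> c *s p + h \<in> H \<longleftrightarrow> c = 0"
  using p_notin_H subspace_H
  by (metis add.left_neutral add_diff_cancel_right' subspace_scale_iff vec.scale_zero_left
      vec.subspace_diff)

lemma decompose: obtains c h where "h \<in> H" "v = c *s p + h"
proof -
  have "v \<in> vec.span (insert p H)"
    by (simp add: span_frame)
  then obtain c where "v - c *s p \<in> H"
    using subspace_H by (auto simp: mem_span_insert_subspace)
  then show ?thesis
    by (intro that[of "v - c *s p" c]) simp_all
qed

lemma affine_translate_notin_H: "h \<in> H \<Longrightarrow> p + h \<notin> H"
  using multiple_plus_mem_H_iff[of h 1] by simp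

lemma inj_on_affine_point: "inj_on affine_point H"
proof (rule inj_onI)
  fix h k assume hk: "h \<in> H" "k \<in> H" "affine_point h = affine_point k"
  then have "p + h \<in> vec.span {p + k}"
    by (metis affine_point_def insertI1 vec.span_base)
  then obtain c where c: "p + h = c *s (p + k)"
    by (auto simp: vec.span_singleton)
  then have eq: "(1 - c) *s p + (h - c *s k) = 0"
    by (simp add: vec.scale_left_diff_distrib vec.scale_right_distrib algebra_simps)
  have "h - c *s k \<in> H"
    using hk subspace_H by (auto intro: vec.subspace_diff vec.subspace_scale)
  then have "c = 1"
    using multiple_plus_mem_H_iff[of "h - c *s k" "1 - c"] eq vec.subspace_0[OF subspace_H]
    by simp
  then show "h = k"
    using c by simp
qed

text \<open>
  Every spanning vector of a point outside \<open>H\<close> has a nonzero coefficient at \<open>p\<close>, and can be rescaled to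
  make this coefficient 1.
\<close>

lemma affine_part_eq:
  assumes U: "vec.subspace U"
  shows "affine_part H U = affine_point ` {h \<in> H. p + h \<in> U}"
proof (intro equalityI subsetI)
  fix P assume "P \<in> affine_part H U"
  then obtain v where v: "P = vec.span {v}" "v \<in> U" "v \<notin> H"
    using span_singleton_subset_iff[OF U] span_singleton_subset_iff[OF subspace_H]
    unfolding affine_part_def proj_point_iff by blast
  obtain c h where h: "h \<in> H" "v = c *s p + h"
    using decompose .
  then have c: "c \<noteq> 0"
    using v multiple_plus_mem_H_iff by blast
  define k where "k = inverse c *s h"
  have v': "v = c *s (p + k)"
    using c h by (simp add: k_def vec.scale_right_distrib)
  then have "P = affine_point k"
    using v c by (simp add: affine_point_def span_scaled_singleton)
  moreover have "k \<in> H"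
    using h subspace_H by (simp add: k_def vec.subspace_scale)
  moreover have "p + k \<in> U"
    using v v' c U by (simp add: subspace_scale_iff)
  ultimately show "P \<in> affine_point ` {h \<in> H. p + h \<in> U}"
    by blast
next
  fix P assume "P \<in> affine_point ` {h \<in> H. p + h \<in> U}"
  then obtain h where h: "h \<in> H" "p + h \<in> U" "P = vec.span {p + h}"
    by (auto simp: affine_point_def)
  moreover have "p + h \<noteq> 0"
    using affine_translate_notin_H[OF h(1)] vec.subspace_0[OF subspace_H] by metis
  ultimately show "P \<in> affine_part H U"
    using U subspace_H affine_translate_notin_H[OF h(1)]
    by (auto simp: affine_part_def proj_point_iff span_singleton_subset_iff)
qed

lemma AG_points_eq: "AG_points H = affine_point ` H"
  using affine_part_eq[OF vec.subspace_UNIV] by simp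

lemma card_AG_points: "card (AG_points H) = CARD('a) ^ vec.dim H"
  by (simp add: AG_points_eq card_image[OF inj_on_affine_point] card_subspace[OF subspace_H])

section \<open>Parallel classes\<close>

text \<open>
  The blocks are the cosets of \<open>D\<close>: if \<open>p + h\<close> lies in \<open>U\<close>, then \<open>p + k\<close> lies in \<open>U\<close> exactly
  if \<open>k - h\<close> does, that is, lies in \<open>U \<inter> H = D\<close>. Conversely \<open>D\<close> and \<open>p + h\<close> span such a \<open>U\<close>.
\<close>

lemma parallel_class_eq:
  assumes D: "vec.subspace D" "vec.dim D = i" "D \<subseteq> H"
  shows "parallel_class H i D = (\<lambda>h. affine_point ` {k \<in> H. k - h \<in> D}) ` H"
proof (intro equalityI subsetI)
  fix A assume "A \<in> parallel_class H i D"
  then obtain U where U: "A = affine_part H U" "vec.subspace U" "\<not> U \<subseteq> H" "U \<inter> H = D"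
    by (auto simp: parallel_class_def proj_space_def)
  then have "A = affine_point ` {h \<in> H. p + h \<in> U}"
    by (simp add: affine_part_eq)
  moreover obtain h where h: "h \<in> H" "p + h \<in> U"
  proof -
    obtain u where u: "u \<in> U" "u \<notin> H"
      using U by auto
    obtain c h where h: "h \<in> H" "u = c *s p + h"
      using decompose .
    then have c: "c \<noteq> 0"
      using u multiple_plus_mem_H_iff by blast
    have "u = c *s (p + inverse c *s h)"
      using c h by (simp add: vec.scale_right_distrib)
    then have "p + inverse c *s h \<in> U"
      using u(1) c U by (simp add: subspace_scale_iff)
    moreover have "inverse c *s h \<in> H"
      using h subspace_H by (simp add: vec.subspace_scale)
    ultimately show ?thesis
      using that by blast
  qed
  moreover have "p + k \<in> U \<longleftrightarrow> k - h \<in> D" if "k \<in> H" for k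
  proof -
    have "k - h \<in> H"
      using that h subspace_H by (simp add: vec.subspace_diff)
    moreover have "p + k \<in> U \<longleftrightarrow> k - h \<in> U"
      using vec.subspace_diff[OF U(2), of "p + k" "p + h"]
        vec.subspace_add[OF U(2), of "k - h" "p + h"] h(2) by (auto simp: algebra_simps)
    ultimately show ?thesis
      using U(4) by auto
  qed
  ultimately show "A \<in> (\<lambda>h. affine_point ` {k \<in> H. k - h \<in> D}) ` H"
    by (intro image_eqI[where x = h]) (auto intro!: image_cong)
next
  fix A assume "A \<in> (\<lambda>h. affine_point ` {k \<in> H. k - h \<in> D}) ` H"
  then obtain h where h: "h \<in> H" "A = affine_point ` {k \<in> H. k - h \<in> D}"
    by auto
  define U where "U = vec.span (insert (p + h) D)"
  have memU: "v \<in> U \<longleftrightarrow> (\<exists>c. v - c *s (p + h) \<in> D)" for v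
    using D(1) by (simp add: U_def mem_span_insert_subspace)
  \<comment> \<open>Since \<open>p\<close> is independent of \<open>H\<close>, the coefficient of \<open>p + h\<close> can be read off modulo \<open>H\<close>.\<close>
  have coeff: "v - c *s (p + h) \<in> D \<Longrightarrow> v - a *s p \<in> H \<Longrightarrow> c = a" for v a c
  proof -
    assume "v - c *s (p + h) \<in> D" "v - a *s p \<in> H"
    then have "(v - c *s (p + h)) - (v - a *s p) \<in> H"
      using D(3) by (blast intro: vec.subspace_diff[OF subspace_H])
    then have "(v - c *s (p + h)) - (v - a *s p) + c *s h \<in> H"
      using h(1) subspace_H by (blast intro: vec.subspace_add vec.subspace_scale)
    moreover have "(v - c *s (p + h)) - (v - a *s p) + c *s h = (a - c) *s p + 0"
      by (simp add: vec.scale_left_diff_distrib vec.scale_right_distrib)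
    ultimately have "a - c = 0"
      using multiple_plus_mem_H_iff[OF vec.subspace_0[OF subspace_H], of "a - c"] by metis
    then show "c = a" by simp
  qed
  have "p + h \<notin> D"
    using affine_translate_notin_H[OF h(1)] D(3) by auto
  then have "proj_space i U"
    using D by (simp add: proj_space_def U_def vec.dim_insert vec.span_eq_iff[THEN iffD2])
  moreover have "\<not> U \<subseteq> H"
    using affine_translate_notin_H[OF h(1)] vec.span_base[of "p + h" "insert (p + h) D"]
    by (auto simp: U_def)
  moreover have "U \<inter> H = D"
  proof (intro equalityI subsetI)
    fix v assume "v \<in> U \<inter> H"
    then obtain c where "v - c *s (p + h) \<in> D" "v - 0 *s p \<in> H"
      by (auto simp: memU)
    then show "v \<in> D"
      using coeff by fastforce
  qed (use D in \<open>auto simp: U_def intro: vec.span_base\<close>)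
  moreover have "A = affine_part H U"
  proof -
    have "p + k \<in> U \<longleftrightarrow> k - h \<in> D" if "k \<in> H" for k
    proof
      assume "p + k \<in> U"
      then obtain c where c: "p + k - c *s (p + h) \<in> D"
        by (auto simp: memU)
      then have "c = 1"
        using coeff[of "p + k" c 1] that by simp
      then show "k - h \<in> D"
        using c by simp
    next
      assume "k - h \<in> D"
      then show "p + k \<in> U"
        by (auto simp: memU intro!: exI[where x = 1])
    qed
    then show ?thesis
      using affine_part_eq[of U] by (auto simp: h(2) U_def intro!: arg_cong[where f = "(`) _"])
  qed
  ultimately show "A \<in> parallel_class H i D"
    by (auto simp: parallel_class_def)
qed

lemma card_coset:
  assumes "vec.subspace D" "D \<subseteq> H" "h \<in> H"
  shows "card {k \<in> H. k - h \<in> D} = card D"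
proof -
  have "{k \<in> H. k - h \<in> D} = (+) h ` D"
  proof (intro equalityI subsetI)
    fix k assume "k \<in> (+) h ` D"
    then show "k \<in> {k \<in> H. k - h \<in> D}"
      using assms vec.subspace_add[OF subspace_H assms(3)] by auto
  next
    fix k assume "k \<in> {k \<in> H. k - h \<in> D}"
    then show "k \<in> (+) h ` D"
      by (intro image_eqI[where x = "k - h"]) auto
  qed
  then show ?thesis
    by (simp add: card_image)
qed

lemma partition_on_parallel_class:
  assumes D: "vec.subspace D" "vec.dim D = i" "D \<subseteq> H"
  shows "partition_on (AG_points H) (parallel_class H i D)"
proof -
  define R where "R = {(h, k). h \<in> H \<and> k \<in> H \<and> k - h \<in> D}"
  have "equiv H R"
  proof (rule equivI)
    show "R \<subseteq> H \<times> H" by (auto simp: R_def)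
    show "refl_on H R"
      using vec.subspace_0[OF D(1)] by (auto simp: R_def refl_on_def)
    show "sym R"
      using diff_swap_mem_iff[OF D(1)] by (auto simp: R_def sym_def)
    show "trans R"
    proof (rule transI)
      fix x y z assume "(x, y) \<in> R" "(y, z) \<in> R"
      then show "(x, z) \<in> R"
        using vec.subspace_add[OF D(1), of "y - x" "z - y"] by (auto simp: R_def)
    qed
  qed
  then have part: "partition_on H (H // R)"
    by (rule partition_on_quotient)
  have quot: "H // R = (\<lambda>h. {k \<in> H. k - h \<in> D}) ` H"
    by (auto simp: quotient_def R_def)
  have cls: "parallel_class H i D = (`) affine_point ` (H // R)"
    unfolding parallel_class_eq[OF D] quot by (simp add: image_image)
  moreover have "{} \<notin> (`) affine_point ` (H // R)"
    using partition_onD3[OF part] by auto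
  ultimately show ?thesis
    using partition_on_inj_image[OF part inj_on_affine_point]
    by (simp add: AG_points_eq)
qed

lemma card_parallel_class:
  assumes D: "vec.subspace D" "vec.dim D = i" "D \<subseteq> H"
  shows "card (parallel_class H i D) = CARD('a) ^ (vec.dim H - i)"
proof -
  note part = partition_on_parallel_class[OF D]
  have "card A = CARD('a) ^ i" if "A \<in> parallel_class H i D" for A
  proof -
    obtain h where h: "h \<in> H" "A = affine_point ` {k \<in> H. k - h \<in> D}"
      using \<open>A \<in> _\<close> unfolding parallel_class_eq[OF D] by auto
    then have "card A = card {k \<in> H. k - h \<in> D}"
      by (simp add: card_image inj_on_subset[OF inj_on_affine_point])
    then show ?thesis
      using card_coset[OF D(1,3) h(1)] card_subspace[OF D(1)] D(2) by simp
  qed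
  moreover have "A \<inter> B = {}" if "A \<in> parallel_class H i D" "B \<in> parallel_class H i D" "A \<noteq> B" for A B
    using partition_onD2[OF part] that by (auto simp: disjoint_def)
  ultimately have "CARD('a) ^ i * card (parallel_class H i D) = card (\<Union> (parallel_class H i D))"
    by (intro card_partition) auto
  also have "\<dots> = CARD('a) ^ vec.dim H"
    using partition_onD1[OF part] card_AG_points by simp
  also have "\<dots> = CARD('a) ^ i * CARD('a) ^ (vec.dim H - i)"
    using vec.dim_subset[OF D(3)] D(2) by (simp flip: power_add)
  finally show ?thesis
    by simp
qed

section \<open>Parallel factors\<close>

text \<open>
  The line joining two affine points meets infinity in the direction \<open>h - k\<close>, and the factor of \<open>D\<close>
  consists of the edges whose direction lies in \<open>D\<close>.
\<close>

lemma edge_mem_parallel_factor_iff: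
  assumes D: "vec.subspace D" "vec.dim D = i" "D \<subseteq> H" and hk: "h \<in> H" "k \<in> H" "h \<noteq> k"
  shows "{affine_point h, affine_point k} \<in> parallel_factor H i D \<longleftrightarrow> h - k \<in> D"
proof -
  have inj: "affine_point x = affine_point y \<longleftrightarrow> x = y" if "x \<in> H" "y \<in> H" for x y
    using inj_on_eq_iff[OF inj_on_affine_point that] .
  have mem: "affine_point x \<in> affine_point ` {k \<in> H. k - a \<in> D} \<longleftrightarrow> x - a \<in> D"
    if "x \<in> H" for x a
    using that inj by (auto simp: image_iff)
  have "{affine_point h, affine_point k} \<in> parallel_factor H i D \<longleftrightarrow>
      (\<exists>a\<in>H. h - a \<in> D \<and> k - a \<in> D)"
    unfolding parallel_factor_def parallel_class_eq[OF D]
    using hk inj[OF hk(1,2)] by (simp add: complete_graph_def mem card_2_iff')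
  also have "\<dots> \<longleftrightarrow> h - k \<in> D"
  proof
    assume "\<exists>a\<in>H. h - a \<in> D \<and> k - a \<in> D"
    then obtain a where "h - a \<in> D" "k - a \<in> D"
      by auto
    then have "(h - a) - (k - a) \<in> D"
      by (rule vec.subspace_diff[OF D(1)])
    then show "h - k \<in> D"
      by simp
  next
    assume "h - k \<in> D"
    then show "\<exists>a\<in>H. h - a \<in> D \<and> k - a \<in> D"
      using hk vec.subspace_0[OF D(1)] by (intro bexI[where x = k]) auto
  qed
  finally show ?thesis .
qed

lemma edges_of_complete_graph:
  "e \<in> complete_graph (AG_points H) \<longleftrightarrow>
     (\<exists>h\<in>H. \<exists>k\<in>H. h \<noteq> k \<and> e = {affine_point h, affine_point k})"
proof
  assume "e \<in> complete_graph (AG_points H)"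
  then have "card e = 2" and e: "e \<subseteq> affine_point ` H"
    by (simp_all add: complete_graph_def AG_points_eq)
  then obtain P Q where "e = {P, Q}" "P \<noteq> Q"
    by (auto simp: card_2_iff)
  moreover from this e obtain h k where "h \<in> H" "P = affine_point h" "k \<in> H" "Q = affine_point k"
    by (simp add: image_iff) metis
  ultimately show "\<exists>h\<in>H. \<exists>k\<in>H. h \<noteq> k \<and> e = {affine_point h, affine_point k}"
    by (rule_tac bexI[where x = h], rule_tac bexI[where x = k]) auto
next
  assume "\<exists>h\<in>H. \<exists>k\<in>H. h \<noteq> k \<and> e = {affine_point h, affine_point k}"
  then obtain h k where hk: "h \<in> H" "k \<in> H" "h \<noteq> k" "e = {affine_point h, affine_point k}"
    by blast
  then have "affine_point h \<noteq> affine_point k"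
    using inj_on_eq_iff[OF inj_on_affine_point] by blast
  then show "e \<in> complete_graph (AG_points H)"
    using hk by (simp add: complete_graph_def AG_points_eq)
qed

lemma parallel_factor_subset:
  assumes D: "vec.subspace D" "vec.dim D = i" "D \<subseteq> H"
  shows "parallel_factor H i D \<subseteq> complete_graph (AG_points H)"
proof
  fix e assume "e \<in> parallel_factor H i D"
  then obtain A where A: "A \<in> parallel_class H i D" "e \<subseteq> A" "card e = 2"
    by (auto simp: parallel_factor_def complete_graph_def)
  have "A \<subseteq> AG_points H"
    using partition_onD1[OF partition_on_parallel_class[OF D]] A(1) by (simp add: Union_upper)
  then show "e \<in> complete_graph (AG_points H)"
    using A by (simp add: complete_graph_def)
qed

text \<open>
  The neighbours of the point at \<open>h\<close> are the other points of the coset of \<open>D\<close> through \<open>h\<close>.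
\<close>

lemma is_factor_parallel_factor:
  assumes D: "vec.subspace D" "vec.dim D = i" "D \<subseteq> H"
  shows "is_factor (AG_points H) (CARD('a) ^ i - 1) (parallel_factor H i D)"
  unfolding is_factor_def
proof (intro conjI ballI)
  show "parallel_factor H i D \<subseteq> complete_graph (AG_points H)"
    by (rule parallel_factor_subset[OF D])
  fix P assume "P \<in> AG_points H"
  then obtain h where h: "h \<in> H" "P = affine_point h"
    by (auto simp: AG_points_eq)
  have inj: "affine_point x = affine_point y \<longleftrightarrow> x = y" if "x \<in> H" "y \<in> H" for x y
    using inj_on_eq_iff[OF inj_on_affine_point that] .
  define N where "N = {k \<in> H. k - h \<in> D} - {h}"
  have "{e \<in> parallel_factor H i D. P \<in> e} = (\<lambda>k. {P, affine_point k}) ` N"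
  proof (intro equalityI subsetI)
    fix e assume e: "e \<in> {e \<in> parallel_factor H i D. P \<in> e}"
    then have "e \<in> complete_graph (AG_points H)"
      using subsetD[OF parallel_factor_subset[OF D]] by simp
    then obtain x y where xy: "x \<in> H" "y \<in> H" "x \<noteq> y" "e = {affine_point x, affine_point y}"
      unfolding edges_of_complete_graph by (elim bexE conjE)
    have xyD: "x - y \<in> D"
      using e xy edge_mem_parallel_factor_iff[OF D xy(1-3)] by simp
    have "P = affine_point x \<or> P = affine_point y"
      using e xy(4) by simp
    then have "h = x \<or> h = y"
      using inj xy(1,2) h by simp
    then show "e \<in> (\<lambda>k. {P, affine_point k}) ` N"
    proof
      assume "h = x"
      then show ?thesis
        using xy h xyD diff_swap_mem_iff[OF D(1), of x y]
        by (intro image_eqI[where x = y]) (simp_all add: N_def)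
    next
      assume "h = y"
      then show ?thesis
        using xy h xyD by (intro image_eqI[where x = x]) (simp_all add: N_def insert_commute)
    qed
  next
    fix e assume "e \<in> (\<lambda>k. {P, affine_point k}) ` N"
    then obtain k where k: "k \<in> H" "k - h \<in> D" "h \<noteq> k" "e = {P, affine_point k}"
      by (auto simp: N_def)
    then show "e \<in> {e \<in> parallel_factor H i D. P \<in> e}"
      using h(2) edge_mem_parallel_factor_iff[OF D h(1) k(1,3)] diff_swap_mem_iff[OF D(1), of h k]
      by simp
  qed
  moreover have "inj_on (\<lambda>k. {P, affine_point k}) N"
  proof (rule inj_onI)
    fix k l assume kl: "k \<in> N" "l \<in> N" "{P, affine_point k} = {P, affine_point l}"
    then have "affine_point k = affine_point l"
      by (metis doubleton_eq_iff)
    then show "k = l"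
      using inj kl(1,2) by (simp add: N_def)
  qed
  ultimately have "card {e \<in> parallel_factor H i D. P \<in> e} = card N"
    by (simp add: card_image)
  also have "\<dots> = card D - 1"
    using card_coset[OF D(1,3) h(1)] h(1) vec.subspace_0[OF D(1)] by (simp add: N_def)
  finally show "card {e \<in> parallel_factor H i D. P \<in> e} = CARD('a) ^ i - 1"
    using card_subspace[OF D(1)] D(2) by simp
qed

text \<open>
  A subspace is determined by its factor as the set of directions of the edges, and it suffices to look
  at the edges through the origin.
\<close>

lemma inj_on_parallel_factor:
  "inj_on (parallel_factor H i) {D. vec.subspace D \<and> vec.dim D = i \<and> D \<subseteq> H}"
proof (rule inj_onI, clarify)
  fix D E assume D: "vec.subspace D" "i = vec.dim D" "D \<subseteq> H"
    and E: "vec.subspace E" "vec.dim E = vec.dim D" "E \<subseteq> H"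
    and eq: "parallel_factor H (vec.dim D) D = parallel_factor H (vec.dim D) E"
  have "d \<in> D \<longleftrightarrow> d \<in> E" for d
  proof (cases "d \<in> H \<and> d \<noteq> 0")
    case True
    then show ?thesis
      using edge_mem_parallel_factor_iff[OF D(1) refl D(3), of d 0]
        edge_mem_parallel_factor_iff[OF E, of d 0] eq vec.subspace_0[OF subspace_H] by auto
  qed (use D E in \<open>auto intro: vec.subspace_0\<close>)
  then show "D = E"
    by auto
qed

section \<open>Factorizations and decompositions\<close>

lemma uniform_cover_iff:
  assumes "\<And>D. D \<in> T \<Longrightarrow> vec.subspace D"
  shows "uniform_cover H f T \<longleftrightarrow> (\<forall>v\<in>H. v \<noteq> 0 \<longrightarrow> card {D \<in> T. v \<in> D} = f)"
proof -
  have pencil: "{D \<in> T. vec.span {v} \<subseteq> D} = {D \<in> T. v \<in> D}" for v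
    using assms span_singleton_subset_iff[of _ v] by blast
  have "uniform_cover H f T \<longleftrightarrow>
      (\<forall>v. v \<noteq> 0 \<longrightarrow> vec.span {v} \<subseteq> H \<longrightarrow> card {D \<in> T. vec.span {v} \<subseteq> D} = f)"
    unfolding uniform_cover_def proj_point_iff by blast
  then show ?thesis
    unfolding pencil span_singleton_subset_iff[OF subspace_H] by blast
qed

text \<open>
  Edges occur with a multiplicity that depends only on their direction, and every point at infinity is
  the direction of some edge. So having all edge multiplicities equal to \<open>\<mu>\<close> is the covering condition.
\<close>

lemma factorization_iff_uniform_cover:
  assumes T: "T \<subseteq> {D. vec.subspace D \<and> vec.dim D = i \<and> D \<subseteq> H}"
  shows "is_factorization mu (AG_points H) (CARD('a) ^ i - 1)
           (image_mset (parallel_factor H i) (mset_set T)) \<longleftrightarrow> uniform_cover H mu T"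
    (is "is_factorization mu ?V ?m ?F \<longleftrightarrow> _")
proof -
  have "is_factor ?V ?m E" if "E \<in># ?F" for E
    using that T is_factor_parallel_factor by auto
  then have "is_factorization mu ?V ?m ?F \<longleftrightarrow>
      (\<forall>e. card {D \<in> T. e \<in> parallel_factor H i D} =
        (if e \<in> complete_graph ?V then mu else 0))"
    unfolding is_factorization_def complete_multigraph_def multiset_eq_iff
    by (simp add: count_edge_sum count_mset_set' if_distrib cong: if_cong)
  also have "\<dots> \<longleftrightarrow>
      (\<forall>e\<in>complete_graph ?V. card {D \<in> T. e \<in> parallel_factor H i D} = mu)"
  proof -
    have "card {D \<in> T. e \<in> parallel_factor H i D} = 0" if e: "e \<notin> complete_graph ?V" for e
    proof -
      have "e \<notin> parallel_factor H i D" if "D \<in> T" for D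
        using that T e parallel_factor_subset[of D i] by blast
      then show ?thesis
        by simp
    qed
    then show ?thesis
      by auto
  qed
  also have "\<dots> \<longleftrightarrow> (\<forall>h\<in>H. \<forall>k\<in>H. h \<noteq> k \<longrightarrow> card {D \<in> T. h - k \<in> D} = mu)"
  proof -
    have "{D \<in> T. {affine_point h, affine_point k} \<in> parallel_factor H i D} = {D \<in> T. h - k \<in> D}"
      if hk: "h \<in> H" "k \<in> H" "h \<noteq> k" for h k
    proof (rule Collect_cong, rule conj_cong[OF refl])
      fix D assume "D \<in> T"
      then have "vec.subspace D" "vec.dim D = i" "D \<subseteq> H"
        using T by auto
      then show "{affine_point h, affine_point k} \<in> parallel_factor H i D \<longleftrightarrow> h - k \<in> D"
        by (rule edge_mem_parallel_factor_iff[OF _ _ _ hk])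
    qed
    moreover have "(\<forall>e\<in>complete_graph ?V. Q e) \<longleftrightarrow>
        (\<forall>h\<in>H. \<forall>k\<in>H. h \<noteq> k \<longrightarrow> Q {affine_point h, affine_point k})" for Q
      unfolding Ball_def edges_of_complete_graph by blast
    ultimately show ?thesis
      by simp
  qed
  also have "\<dots> \<longleftrightarrow> (\<forall>v\<in>H. v \<noteq> 0 \<longrightarrow> card {D \<in> T. v \<in> D} = mu)"
  proof
    assume *: "\<forall>h\<in>H. \<forall>k\<in>H. h \<noteq> k \<longrightarrow> card {D \<in> T. h - k \<in> D} = mu"
    show "\<forall>v\<in>H. v \<noteq> 0 \<longrightarrow> card {D \<in> T. v \<in> D} = mu"
      using *[rule_format, of _ 0] vec.subspace_0[OF subspace_H] by simp
  next
    assume "\<forall>v\<in>H. v \<noteq> 0 \<longrightarrow> card {D \<in> T. v \<in> D} = mu"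
    then show "\<forall>h\<in>H. \<forall>k\<in>H. h \<noteq> k \<longrightarrow> card {D \<in> T. h - k \<in> D} = mu"
      using vec.subspace_diff[OF subspace_H] by simp
  qed
  also have "\<dots> \<longleftrightarrow> uniform_cover H mu T"
    using T by (subst uniform_cover_iff) auto
  finally show ?thesis .
qed

text \<open>
  A summand of the family is indexed by a subset of \<open>T\<close>, because the indices in \<open>T\<close> have multiplicity one.
  Conversely a cover \<open>S\<close> is complemented by \<open>T - S\<close>, which covers each point
  \<open>\<lambda> - f\<close> times.
\<close>

lemma decomposable_iff_proper_cover:
  assumes T: "T \<subseteq> {D. vec.subspace D \<and> vec.dim D = i \<and> D \<subseteq> H}"
    and lam: "uniform_cover H lam T"
  shows "decomposable lam (AG_points H) (CARD('a) ^ i - 1)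
           (image_mset (parallel_factor H i) (mset_set T)) \<longleftrightarrow>
         (\<exists>f S. 1 \<le> f \<and> f < lam \<and> S \<subseteq> T \<and> uniform_cover H f S)"
proof
  assume "decomposable lam (AG_points H) (CARD('a) ^ i - 1)
           (image_mset (parallel_factor H i) (mset_set T))"
  then obtain f f' F F' where f: "0 < f" "0 < f'" "f + f' = lam"
    and F: "image_mset (parallel_factor H i) (mset_set T) = F + F'"
      "is_factorization f (AG_points H) (CARD('a) ^ i - 1) F"
    unfolding decomposable_def by (elim exE conjE)
  obtain B C where BC: "mset_set T = B + C" "F = image_mset (parallel_factor H i) B"
    using image_mset_eq_plusD[OF F(1)] by blast
  have le1: "count B D \<le> 1" for D
  proof -
    have "count B D \<le> count (mset_set T) D"
      by (simp add: BC)
    then show ?thesis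
      by (simp add: count_mset_set' split: if_splits)
  qed
  have B: "B = mset_set (set_mset B)"
  proof (intro multiset_eqI)
    fix D
    show "count B D = count (mset_set (set_mset B)) D"
    proof (cases "D \<in># B")
      case True
      then have "0 < count B D"
        by simp
      then have "count B D = 1"
        using le1[of D] by linarith
      then show ?thesis
        using True by (simp add: count_mset_set')
    qed (simp add: count_mset_set' not_in_iff)
  qed
  have "set_mset B \<subseteq> set_mset (mset_set T)"
    by (simp add: BC)
  then have BT: "set_mset B \<subseteq> T"
    by simp
  then have "uniform_cover H f (set_mset B)"
    using factorization_iff_uniform_cover[of "set_mset B" i f] T F(2) BC(2) B by auto
  then show "\<exists>f S. 1 \<le> f \<and> f < lam \<and> S \<subseteq> T \<and> uniform_cover H f S"
    using f BT by (intro exI[of _ f] exI[of _ "set_mset B"]) auto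
next
  assume "\<exists>f S. 1 \<le> f \<and> f < lam \<and> S \<subseteq> T \<and> uniform_cover H f S"
  then obtain f S where f: "1 \<le> f" "f < lam" and S: "S \<subseteq> T" "uniform_cover H f S"
    by blast
  have "uniform_cover H (lam - f) (T - S)"
    unfolding uniform_cover_def
  proof (intro allI impI)
    fix P assume "proj_space 0 P \<and> P \<subseteq> H"
    moreover have "{D \<in> T - S. P \<subseteq> D} = {D \<in> T. P \<subseteq> D} - {D \<in> S. P \<subseteq> D}"
      by auto
    moreover have "{D \<in> S. P \<subseteq> D} \<subseteq> {D \<in> T. P \<subseteq> D}"
      using S by auto
    ultimately show "card {D \<in> T - S. P \<subseteq> D} = lam - f"
      using lam S by (simp add: uniform_cover_def card_Diff_subset)
  qed
  moreover have "mset_set T = mset_set S + mset_set (T - S)"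
    using S by (subst mset_set_Union[symmetric]) (auto simp: Un_absorb1)
  ultimately show "decomposable lam (AG_points H) (CARD('a) ^ i - 1)
           (image_mset (parallel_factor H i) (mset_set T))"
    unfolding decomposable_def
    using f S T factorization_iff_uniform_cover[of S i f] factorization_iff_uniform_cover[of "T - S" i "lam - f"]
    by (intro exI[of _ f] exI[of _ "lam - f"]
        exI[of _ "image_mset (parallel_factor H i) (mset_set S)"]
        exI[of _ "image_mset (parallel_factor H i) (mset_set (T - S))"]) auto
qed

end

lemma ex_affine_frame:
  fixes H :: "('a::{field,finite} ^ 'm::finite) set"
  assumes H: "vec.subspace H" "CARD('m) = vec.dim H + 1"
  obtains p where "affine_frame H p"
proof -
  have "vec.dim H \<noteq> vec.dim (UNIV :: ('a ^ 'm) set)"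
    using H(2) by (simp add: vec_dim_card del: vec.dim_UNIV)
  then have "H \<noteq> UNIV"
    by blast
  then obtain p where p: "p \<notin> H"
    by auto
  have "vec.dim (vec.span (insert p H)) = vec.dim (UNIV :: ('a ^ 'm) set)"
    using p H by (simp add: vec.dim_insert vec.span_eq_iff[THEN iffD2] vec_dim_card del: vec.dim_UNIV)
  then have "vec.span (insert p H) = UNIV"
    by (intro vec.subspace_dim_equal) auto
  then show ?thesis
    using that[of p] H(1) p by (simp add: affine_frame_def)
qed

section \<open>The parallel family of an affine space\<close>

theorem theorem3p1:
  fixes q n i lam :: nat
    and H :: "('a::{field,finite} ^ 'm::finite) set"
  assumes "primepow q" and "CARD('a) = q"
    and "0 < i" and "i < n"
    and "CARD('m) = n + 1" and "CARD('k::finite) = n" and "CARD('l::finite) = n - 1"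
    and "lam = gaussian_binomial TYPE('a ^ 'l) (i - 1)"
    and "proj_space (n - 1) H"
  shows "card (AG_points H) = q ^ n \<and>
         (\<forall>D. proj_space (i - 1) D \<and> D \<subseteq> H \<longrightarrow>
            partition_on (AG_points H) (parallel_class H i D) \<and>
            card (parallel_class H i D) = q ^ (n - i)) \<and>
         is_factorization lam (AG_points H) (q ^ i - 1) (parallel_family H i) \<and>
         simple_family (parallel_family H i) \<and>
         (decomposable lam (AG_points H) (q ^ i - 1) (parallel_family H i) \<longleftrightarrow>
            (\<exists>f S. 1 \<le> f \<and> f < lam \<and> fold_spread f (i - 1) (S :: ('a ^ 'k) set set)))"
proof -
  define spaces where "spaces = {D. proj_space (i - 1) D \<and> D \<subseteq> H}"
  have H: "vec.subspace H" "vec.dim H = n"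
    using assms by (auto simp: proj_space_def)
  obtain p where "affine_frame H p"
    using ex_affine_frame[OF H(1)] H(2) assms by auto
  then interpret affine_frame H p .
  have spaces: "spaces = {D. vec.subspace D \<and> vec.dim D = i \<and> D \<subseteq> H}"
    using assms by (auto simp: spaces_def proj_space_def)
  have family: "parallel_family H i = image_mset (parallel_factor H i) (mset_set spaces)"
    by (simp add: parallel_family_def spaces_def)
  have cover: "uniform_cover H lam spaces"
    unfolding uniform_cover_def
  proof (intro allI impI)
    fix P assume "proj_space 0 P \<and> P \<subseteq> H"
    then have "card {D. vec.subspace D \<and> vec.dim D = Suc (i - 1) \<and> D \<subseteq> H \<and> P \<subseteq> D} = lam"
      using card_subspaces_through_point[OF H(1), where 'l = 'l and j = "i - 1"] H(2) assms by simp
    then show "card {D \<in> spaces. P \<subseteq> D} = lam"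
      using assms by (simp add: spaces conj_assoc)
  qed
  have "card (AG_points H) = q ^ n"
    using card_AG_points H(2) assms by simp
  moreover have "partition_on (AG_points H) (parallel_class H i D) \<and>
      card (parallel_class H i D) = q ^ (n - i)" if "proj_space (i - 1) D \<and> D \<subseteq> H" for D
  proof -
    have "vec.subspace D" "vec.dim D = i" "D \<subseteq> H"
      using that assms by (auto simp: proj_space_def)
    then show ?thesis
      using partition_on_parallel_class card_parallel_class H(2) assms by simp
  qed
  moreover have "is_factorization lam (AG_points H) (q ^ i - 1) (parallel_family H i)"
    using factorization_iff_uniform_cover[of spaces i lam] cover assms by (simp add: family spaces)
  moreover have "simple_family (parallel_family H i)"
  proof -
    have "parallel_family H i = mset_set (parallel_factor H i ` spaces)"
      unfolding family by (rule image_mset_mset_set) (simp add: spaces inj_on_parallel_factor)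
    then show ?thesis
      by (simp add: simple_family_def)
  qed
  moreover have "decomposable lam (AG_points H) (q ^ i - 1) (parallel_family H i) \<longleftrightarrow>
      (\<exists>f S. 1 \<le> f \<and> f < lam \<and> fold_spread f (i - 1) (S :: ('a ^ 'k) set set))"
  proof -
    have "decomposable lam (AG_points H) (q ^ i - 1) (parallel_family H i) \<longleftrightarrow>
        (\<exists>f T. 1 \<le> f \<and> f < lam \<and> T \<subseteq> spaces \<and> uniform_cover H f T)"
      using decomposable_iff_proper_cover[of spaces i lam] cover assms by (simp add: family spaces)
    also have "\<dots> \<longleftrightarrow> (\<exists>f. 1 \<le> f \<and> f < lam \<and> (\<exists>T \<subseteq> spaces. uniform_cover H f T))"
      by blast
    also have "\<dots> \<longleftrightarrow>
        (\<exists>f. 1 \<le> f \<and> f < lam \<and> (\<exists>S :: ('a ^ 'k) set set. fold_spread f (i - 1) S))"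
      using ex_fold_spread_iff[OF H(1), where 'k = 'k and j = "i - 1"] H(2) assms
      by (simp add: spaces_def)
    also have "\<dots> \<longleftrightarrow> (\<exists>f S. 1 \<le> f \<and> f < lam \<and> fold_spread f (i - 1) (S :: ('a ^ 'k) set set))"
      by blast
    finally show ?thesis .
  qed
  ultimately show ?thesis
    by blast
qed

end
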